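(* Given a boolean binary decision tree $T$ over a finite feature set $X$ and a feature $x\in X$, it is possible to compute the number of entities $e$ over $X$ for which $x$ is necessary for $T(e)$ in time $O(|T|^2)$.
   Context: $X$ is a finite set of binary features, each with domain $\{0,1\}$. An entity over $X$ is a function $e:X\to\{0,1\}$. A boolean binary decision tree over $X$ is a binary tree $T$ in which every internal node has two ordered children and is labeled by a test on the value of a single feature of $X$, and leaves are labeled $0$ or $1$; $T(e)$ is the label of the leaf reached from the root by following, at each internal node, the child indicated by the outcome of the test on $e$ (left child if the test is satisfied, right child otherwise). The size $|T|$ is the number of nodes of $T$. A set $S\subseteq X$ is a reason for $T(e)$ if $T(e')=T(e)$ for every entity $e'$ with $e'(y)=e(y)$ for all $y\in S$. A sufficient reason is a reason that is minimal under inclusion. A feature $x$ is necessary for $T(e)$ if it belongs to every sufficient reason for $T(e)$. *)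

theory Defs
  imports Main "HOL-Library.FuncSet"
begin

section \<open>Decision trees and reasons\<close>

text \<open>Entities over \<open>X\<close> are the extensional functions on \<open>X\<close>, so that each
  function \<open>X \<rightarrow> {0,1}\<close> is represented exactly once and entities can be counted.\<close>

definition entities :: "'a set \<Rightarrow> ('a \<Rightarrow> bool) set" where
  "entities X = X \<rightarrow>\<^sub>E UNIV"

text \<open>A test on the value of a binary feature is an arbitrary predicate on \<open>{0,1}\<close>,
  possibly a constant one. A feature may be tested several times on a path.\<close>

datatype (features: 'a) dtree =
  Leaf bool
| Node 'a "bool \<Rightarrow> bool" "'a dtree" "'a dtree"

fun classify :: "'a dtree \<Rightarrow> ('a \<Rightarrow> bool) \<Rightarrow> bool" where
  "classify (Leaf b) e = b"
| "classify (Node y p l r) e = (if p (e y) then classify l e else classify r e)"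

fun nodes :: "'a dtree \<Rightarrow> nat" where
  "nodes (Leaf b) = 1"
| "nodes (Node y p l r) = 1 + nodes l + nodes r"

definition reason :: "'a set \<Rightarrow> 'a dtree \<Rightarrow> ('a \<Rightarrow> bool) \<Rightarrow> 'a set \<Rightarrow> bool" where
  "reason X T e S \<longleftrightarrow>
     S \<subseteq> X \<and> (\<forall>e'\<in>entities X. (\<forall>y\<in>S. e' y = e y) \<longrightarrow> classify T e' = classify T e)"

definition sufficient_reason :: "'a set \<Rightarrow> 'a dtree \<Rightarrow> ('a \<Rightarrow> bool) \<Rightarrow> 'a set \<Rightarrow> bool" where
  "sufficient_reason X T e S \<longleftrightarrow> reason X T e S \<and> (\<forall>S'. S' \<subset> S \<longrightarrow> \<not> reason X T e S')"

definition necessary :: "'a set \<Rightarrow> 'a dtree \<Rightarrow> ('a \<Rightarrow> bool) \<Rightarrow> 'a \<Rightarrow> bool" where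
  "necessary X T e x \<longleftrightarrow> (\<forall>S. sufficient_reason X T e S \<longrightarrow> x \<in> S)"


section \<open>Random access machines\<close>

text \<open>A program is a fixed list of instructions working on registers and on a memory
  that is addressed indirectly through registers. Every instruction costs one step.
  Subtraction is truncated. \<open>Shl\<close> is the left shift; some instruction of this kind is
  unavoidable, because the answer can be \<open>2 ^ card X\<close> for a tree with three nodes.\<close>

datatype instr =
  Const nat nat
| Add nat nat nat
| Sub nat nat nat
| Shl nat nat nat
| Load nat nat
| Store nat nat
| Jump nat
| JumpZero nat nat

text \<open>Program counter, registers, memory.\<close>

type_synonym config = "nat \<times> (nat \<Rightarrow> nat) \<times> (nat \<Rightarrow> nat)"

fun exec :: "instr \<Rightarrow> config \<Rightarrow> config" where
  "exec (Const d k) (pc, r, m) = (Suc pc, r(d := k), m)"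
| "exec (Add d i j) (pc, r, m) = (Suc pc, r(d := r i + r j), m)"
| "exec (Sub d i j) (pc, r, m) = (Suc pc, r(d := r i - r j), m)"
| "exec (Shl d i j) (pc, r, m) = (Suc pc, r(d := r i * 2 ^ r j), m)"
| "exec (Load d i) (pc, r, m) = (Suc pc, r(d := m (r i)), m)"
| "exec (Store i j) (pc, r, m) = (Suc pc, r, m(r i := r j))"
| "exec (Jump q) (pc, r, m) = (q, r, m)"
| "exec (JumpZero i q) (pc, r, m) = (if r i = 0 then q else Suc pc, r, m)"

definition halted :: "instr list \<Rightarrow> config \<Rightarrow> bool" where
  "halted P c \<longleftrightarrow> length P \<le> fst c"

definition step :: "instr list \<Rightarrow> config \<Rightarrow> config" where
  "step P c = (if halted P c then c else exec (P ! fst c) c)"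

fun fits :: "nat \<Rightarrow> config \<Rightarrow> bool" where
  "fits w (pc, r, m) \<longleftrightarrow> (\<forall>i. r i < 2 ^ w) \<and> (\<forall>a. m a < 2 ^ w)"

text \<open>Started in \<open>c\<close>, the program halts after at most \<open>t\<close> steps with \<open>v\<close> in register 0,
  and all numbers occurring on the way have at most \<open>w\<close> bits. The bound \<open>w\<close> prevents
  unit-cost operations on numbers of unreasonable size.\<close>

definition outputs_within :: "instr list \<Rightarrow> nat \<Rightarrow> nat \<Rightarrow> config \<Rightarrow> nat \<Rightarrow> bool" where
  "outputs_within P w t c v \<longleftrightarrow>
     (\<exists>s\<le>t. halted P ((step P ^^ s) c) \<and>
            fst (snd ((step P ^^ s) c)) 0 = v \<and>
            (\<forall>u\<le>s. fits w ((step P ^^ u) c)))"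


section \<open>Inputs\<close>

text \<open>\<open>encode idx a T\<close> lists the contents of consecutive memory cells, from address \<open>a\<close>,
  that store \<open>T\<close> as linked records in preorder: a leaf is a tag and its label; an internal
  node is a tag, the index of its feature, the truth table of its test, and the addresses
  of its left and right child.\<close>

fun encode :: "('a \<Rightarrow> nat) \<Rightarrow> nat \<Rightarrow> 'a dtree \<Rightarrow> nat list" where
  "encode idx a (Leaf b) = [0, of_bool b]"
| "encode idx a (Node y p l r) =
     (let ls = encode idx (a + 6) l;
          rs = encode idx (a + 6 + length ls) r
      in [1, idx y, of_bool (p False), of_bool (p True), a + 6, a + 6 + length ls] @ ls @ rs)"

text \<open>The tree is stored from address 0 on; registers 0, 1, 2 hold the number of features,
  the index of \<open>x\<close>, and the number of cells occupied by the tree. Everything else is zero.\<close>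

definition initial :: "'a set \<Rightarrow> ('a \<Rightarrow> nat) \<Rightarrow> 'a dtree \<Rightarrow> 'a \<Rightarrow> config" where
  "initial X idx T x =
     (let cells = encode idx 0 T
      in (0,
          (\<lambda>_. 0)(0 := card X, 1 := idx x, 2 := length cells),
          (\<lambda>a. if a < length cells then cells ! a else 0)))"

end

theory Submission
  imports Defs
begin

text \<open>A feature \<open>x\<close> is necessary for \<open>T(e)\<close> iff flipping \<open>x\<close> in \<open>e\<close> changes the value of \<open>T\<close>, since
  otherwise \<open>X - {x}\<close> is a reason and contains a sufficient one. The answer is therefore twice the
  number of entities \<open>e\<close> with \<open>e x = 0\<close> on which \<open>T\<close> changes its value when \<open>x\<close> is set to \<open>1\<close>. A
  depth-first traversal of \<open>T\<close> with \<open>x = 0\<close> that records the features fixed so far, and that starts at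
  each leaf a second traversal with \<open>x = 1\<close> under these values, reaches every consistent pair of leaves
  once; a pair with different labels contributes \<open>2 ^ k\<close> where \<open>k\<close> features are still free. At a test
  that the recorded values decide, or that is constant, only one child is entered and no value is
  recorded, so every traversal visits each node at most once.\<close>

section \<open>Necessary features\<close>

lemma reason_mono: "reason X T e S \<Longrightarrow> S \<subseteq> S' \<Longrightarrow> S' \<subseteq> X \<Longrightarrow> reason X T e S'"
  unfolding reason_def by blast

lemma sufficient_reason_exists:
  assumes "finite S" "reason X T e S"
  shows "\<exists>S'\<subseteq>S. sufficient_reason X T e S'"
  using assms
proof (induction S rule: finite_psubset_induct)
  case (psubset S)
  show ?case
  proof (cases "sufficient_reason X T e S")
    case False
    then obtain S' where S': "S' \<subset> S" "reason X T e S'"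
      using psubset.prems by (auto simp: sufficient_reason_def)
    then obtain S'' where "S'' \<subseteq> S'" "sufficient_reason X T e S''"
      using psubset.IH[OF S'] by blast
    with S'(1) show ?thesis by (meson order_trans psubset_imp_subset)
  qed blast
qed

lemma necessary_iff_flip:
  assumes "finite X" "x \<in> X" "e \<in> entities X"
  shows "necessary X T e x \<longleftrightarrow> classify T (e(x := \<not> e x)) \<noteq> classify T e"
proof -
  have flip: "e(x := \<not> e x) \<in> entities X"
    using assms by (auto simp: entities_def PiE_def extensional_def)
  \<comment> \<open>Entities are extensional, so agreement on \<open>X - {x}\<close> is agreement
    everywhere except at \<open>x\<close>; only two candidates remain.\<close>
  have two: "e' = e \<or> e' = e(x := \<not> e x)"
    if "e' \<in> entities X" "\<forall>y\<in>X - {x}. e' y = e y" for e'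
  proof -
    have "e' y = e y" if "y \<noteq> x" for y
      using \<open>e' \<in> entities X\<close> \<open>\<forall>y\<in>X - {x}. e' y = e y\<close> assms(3) that
      by (cases "y \<in> X") (auto simp: entities_def PiE_def extensional_def)
    then have "e' = e(x := e' x)" by (auto simp: fun_eq_iff)
    then obtain v where "e' = e(x := v)" ..
    then show ?thesis by (cases "v = e x") (simp_all add: fun_upd_idem)
  qed
  have *: "reason X T e (X - {x}) \<longleftrightarrow> classify T (e(x := \<not> e x)) = classify T e"
  proof
    assume "reason X T e (X - {x})"
    with flip show "classify T (e(x := \<not> e x)) = classify T e"
      unfolding reason_def by (metis Diff_iff fun_upd_other insertI1)
  next
    assume "classify T (e(x := \<not> e x)) = classify T e"
    with two show "reason X T e (X - {x})"
      unfolding reason_def by (metis Diff_subset)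
  qed
  have "necessary X T e x \<longleftrightarrow> \<not> reason X T e (X - {x})"
  proof
    assume "necessary X T e x"
    then show "\<not> reason X T e (X - {x})"
      using sufficient_reason_exists[of "X - {x}" X T e] assms(1) unfolding necessary_def by blast
  next
    \<comment> \<open>A sufficient reason avoiding \<open>x\<close> lies in \<open>X - {x}\<close>,
      and a reason stays one when enlarged within \<open>X\<close>.\<close>
    assume no: "\<not> reason X T e (X - {x})"
    have "x \<in> S" if "sufficient_reason X T e S" for S
    proof (rule ccontr)
      assume "x \<notin> S"
      from that have S: "reason X T e S" by (simp add: sufficient_reason_def)
      then have "S \<subseteq> X - {x}" using \<open>x \<notin> S\<close> by (auto simp: reason_def)
      with reason_mono[OF S] no show False by blast
    qed
    then show "necessary X T e x" by (simp add: necessary_def)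
  qed
  with * show ?thesis by simp
qed

section \<open>Counting completions of partial entities\<close>

text \<open>The subcube of entities compatible with what a traversal has fixed; \<open>None\<close>
  marks a free feature.\<close>

definition completions :: "'a set \<Rightarrow> ('a \<Rightarrow> bool option) \<Rightarrow> ('a \<Rightarrow> bool) set" where
  "completions X \<sigma> = {e \<in> entities X. \<forall>y\<in>X. \<forall>v. \<sigma> y = Some v \<longrightarrow> e y = v}"

lemma finite_completions: "finite X \<Longrightarrow> finite (completions X \<sigma>)"
  unfolding completions_def entities_def by (simp add: finite_PiE)

lemma completions_value: "e \<in> completions X \<sigma> \<Longrightarrow> y \<in> X \<Longrightarrow> \<sigma> y = Some v \<Longrightarrow> e y = v"
  unfolding completions_def by blast

lemma completions_upd_iff:
  assumes "y \<in> X" "\<sigma> y = None"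
  shows "e \<in> completions X (\<sigma>(y := Some v)) \<longleftrightarrow> e \<in> completions X \<sigma> \<and> e y = v"
proof
  assume e: "e \<in> completions X (\<sigma>(y := Some v))"
  have "e z = u" if "z \<in> X" "\<sigma> z = Some u" for z u
    using completions_value[OF e, of z u] that assms(2) by (cases "z = y") simp_all
  moreover have "e y = v"
    using completions_value[OF e, of y v] assms(1) by simp
  ultimately show "e \<in> completions X \<sigma> \<and> e y = v"
    using e by (simp add: completions_def)
qed (use assms in \<open>simp add: completions_def\<close>)

lemma card_completions_split:
  assumes "finite X" "y \<in> X" "\<sigma> y = None"
  shows "card {e \<in> completions X \<sigma>. Q e} =
    card {e \<in> completions X (\<sigma>(y := Some v)). Q e} +
    card {e \<in> completions X (\<sigma>(y := Some (\<not> v))). Q e}"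
proof -
  have "{e \<in> completions X \<sigma>. Q e} =
      {e \<in> completions X (\<sigma>(y := Some v)). Q e} \<union> {e \<in> completions X (\<sigma>(y := Some (\<not> v))). Q e}"
    using assms by (auto simp: completions_upd_iff)
  moreover have "{e \<in> completions X (\<sigma>(y := Some v)). Q e} \<inter>
      {e \<in> completions X (\<sigma>(y := Some (\<not> v))). Q e} = {}"
    using assms by (auto simp: completions_upd_iff)
  ultimately show ?thesis
    using finite_completions[OF assms(1)] by (simp add: card_Un_disjoint)
qed

lemma completions_upd:
  assumes "y \<in> X" "e \<in> completions X (\<sigma>(y := Some v))"
  shows "e(y := w) \<in> completions X (\<sigma>(y := Some w))"
proof -
  have "e(y := w) \<in> entities X"
    using assms by (auto simp: completions_def entities_def PiE_def extensional_def)
  moreover have "\<forall>z\<in>X. \<forall>u. (\<sigma>(y := Some w)) z = Some u \<longrightarrow> (e(y := w)) z = u"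
    using assms(2) by (simp add: completions_def)
  ultimately show ?thesis unfolding completions_def by blast
qed

text \<open>Overwriting the value at \<open>y\<close> is a bijection between the two faces of a
  cube. This yields the halving below and transports counts between \<open>x = 0\<close> and
  \<open>x = 1\<close>.\<close>

lemma card_completions_upd:
  assumes "y \<in> X"
  shows "card {e \<in> completions X (\<sigma>(y := Some v)). Q (e(y := w))} =
    card {e \<in> completions X (\<sigma>(y := Some w)). Q e}" (is "card ?A = card ?B")
proof (rule bij_betw_same_card)
  have A: "e(y := v) = e" if "e \<in> ?A" for e
    using completions_value[OF _ assms, of e "\<sigma>(y := Some v)" v] that by (simp add: fun_upd_idem)
  have B: "e(y := w) = e" if "e \<in> ?B" for e
    using completions_value[OF _ assms, of e "\<sigma>(y := Some w)" w] that by (simp add: fun_upd_idem)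
  show "bij_betw (\<lambda>e. e(y := w)) ?A ?B"
  proof (rule bij_betw_byWitness[where f' = "\<lambda>e. e(y := v)"])
    show "\<forall>e\<in>?A. e(y := w, y := v) = e" "\<forall>e\<in>?B. e(y := v, y := w) = e"
      unfolding fun_upd_upd by (rule ballI, erule A, rule ballI, erule B)
    show "(\<lambda>e. e(y := w)) ` ?A \<subseteq> ?B"
      using completions_upd[OF assms, of _ \<sigma> v w] by (simp add: image_subset_iff)
    show "(\<lambda>e. e(y := v)) ` ?B \<subseteq> ?A"
    proof (rule image_subsetI)
      fix e assume e: "e \<in> ?B"
      then have "e(y := v) \<in> completions X (\<sigma>(y := Some v))"
        using completions_upd[OF assms, of e \<sigma> w v] by simp
      moreover have "Q (e(y := v, y := w))"
        using e B[OF e] by (simp only: fun_upd_upd mem_Collect_eq)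
      ultimately show "e(y := v) \<in> ?A" by simp
    qed
  qed
qed

lemma card_completions_half:
  assumes "finite X" "y \<in> X" "\<sigma> y = None"
  shows "card (completions X \<sigma>) = 2 * card (completions X (\<sigma>(y := Some v)))"
  using card_completions_split[of X y \<sigma>, OF assms, of "\<lambda>_. True" v]
    card_completions_upd[OF assms(2), of \<sigma> v "\<lambda>_. True" "\<not> v"] by simp

lemma card_completions_None:
  assumes "finite X"
  shows "card (completions X (\<lambda>_. None)) = 2 ^ card X"
  using assms by (simp add: completions_def entities_def card_PiE)

text \<open>Flipping \<open>x\<close> is an involution that preserves the condition of
  \<open>necessary_iff_flip\<close>, so both faces contribute equally and the face
  \<open>x = 0\<close> suffices.\<close>

lemma card_necessary:
  assumes "finite X" "x \<in> X"
  shows "card {e \<in> entities X. necessary X T e x} =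
    2 * card {e \<in> completions X [x \<mapsto> False]. classify T e \<noteq> classify T (e(x := True))}"
proof -
  have F: "\<not> e x" "e(x := False) = e" if "e \<in> completions X [x \<mapsto> False]" for e
    using completions_value[OF that assms(2), of False] by (simp_all add: fun_upd_idem)
  let ?Q = "\<lambda>e. classify T (e(x := \<not> e x)) \<noteq> classify T e"
  let ?D = "{e \<in> completions X [x \<mapsto> False]. classify T e \<noteq> classify T (e(x := True))}"
  have "{e \<in> entities X. necessary X T e x} = {e \<in> completions X (\<lambda>_. None). ?Q e}"
    using necessary_iff_flip[OF assms] by (auto simp: completions_def)
  then have 1: "card {e \<in> entities X. necessary X T e x} =
      card {e \<in> completions X [x \<mapsto> False]. ?Q e} + card {e \<in> completions X [x \<mapsto> True]. ?Q e}"
    using card_completions_split[OF assms, of "\<lambda>_. None" ?Q False] by simp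
  have 2: "{e \<in> completions X [x \<mapsto> False]. ?Q e} = ?D"
    by (rule Collect_cong) (auto simp: F)
  have 3: "card {e \<in> completions X [x \<mapsto> True]. ?Q e} =
      card {e \<in> completions X [x \<mapsto> False]. ?Q (e(x := True))}"
    by (rule card_completions_upd[OF assms(2), symmetric])
  have 4: "{e \<in> completions X [x \<mapsto> False]. ?Q (e(x := True))} = ?D"
    by (rule Collect_cong) (auto simp: F)
  show ?thesis unfolding 1 2 3 4 by (rule mult_2[symmetric])
qed

section \<open>Runs of the machine\<close>

definition bounded :: "nat \<Rightarrow> config \<Rightarrow> bool" where
  "bounded W c \<longleftrightarrow> (\<forall>i. fst (snd c) i < W) \<and> (\<forall>a. snd (snd c) a < W)"

lemma bounded_simps [simp]:
  "bounded W (pc, r, m) \<longleftrightarrow> (\<forall>i. r i < W) \<and> (\<forall>a. m a < W)"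
  by (simp add: bounded_def)

lemma fits_iff_bounded: "fits w c \<longleftrightarrow> bounded (2 ^ w) c"
  by (cases c) simp

text \<open>A Hoare-style judgement with a time budget \<open>t\<close>. Budgets may be relaxed, and
  they add up under \<open>runs_trans\<close>.\<close>

definition runs :: "instr list \<Rightarrow> nat \<Rightarrow> nat \<Rightarrow> config \<Rightarrow> (config \<Rightarrow> bool) \<Rightarrow> bool" where
  "runs P W t c Q \<longleftrightarrow>
     (\<exists>s\<le>t. Q ((step P ^^ s) c) \<and> (\<forall>u\<le>s. bounded W ((step P ^^ u) c)))"

lemma runs_done: "bounded W c \<Longrightarrow> Q c \<Longrightarrow> runs P W t c Q"
  unfolding runs_def by (intro exI[of _ 0]) auto

lemma runs_step:
  assumes "pc < length P" "bounded W (pc, r, m)" "0 < t"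
    and "runs P W (t - 1) (exec (P ! pc) (pc, r, m)) Q"
  shows "runs P W t (pc, r, m) Q"
proof -
  from assms(4) obtain s where s: "s \<le> t - 1" "Q ((step P ^^ s) (exec (P ! pc) (pc, r, m)))"
    "\<And>u. u \<le> s \<Longrightarrow> bounded W ((step P ^^ u) (exec (P ! pc) (pc, r, m)))"
    unfolding runs_def by blast
  have e: "exec (P ! pc) (pc, r, m) = step P (pc, r, m)"
    using assms(1) by (simp add: step_def halted_def)
  have "bounded W ((step P ^^ u) (pc, r, m))" if "u \<le> Suc s" for u
    using that s(3)[of "u - 1"] assms(2) by (cases u) (auto simp: e funpow_swap1)
  with s(1,2) assms(3) show ?thesis
    unfolding runs_def by (intro exI[of _ "Suc s"]) (auto simp: e funpow_swap1)
qed

lemma runs_mono: "runs P W t c Q \<Longrightarrow> t \<le> t' \<Longrightarrow> (\<And>c. Q c \<Longrightarrow> Q' c) \<Longrightarrow> runs P W t' c Q'"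
  unfolding runs_def by (meson order_trans)

lemma runs_trans:
  assumes "runs P W t c Q" and "\<And>c'. Q c' \<Longrightarrow> runs P W t' c' R"
  shows "runs P W (t + t') c R"
proof -
  from assms(1) obtain s where s: "s \<le> t" "Q ((step P ^^ s) c)"
    "\<And>u. u \<le> s \<Longrightarrow> bounded W ((step P ^^ u) c)"
    unfolding runs_def by blast
  from assms(2)[OF s(2)] obtain s' where s': "s' \<le> t'" "R ((step P ^^ s') ((step P ^^ s) c))"
    "\<And>u. u \<le> s' \<Longrightarrow> bounded W ((step P ^^ u) ((step P ^^ s) c))"
    unfolding runs_def by blast
  have "bounded W ((step P ^^ u) c)" if "u \<le> s' + s" for u
  proof (cases "u \<le> s")
    case False
    then have "u = (u - s) + s" by simp
    then have "(step P ^^ u) c = (step P ^^ (u - s)) ((step P ^^ s) c)"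
      by (metis comp_apply funpow_add)
    with s'(3)[of "u - s"] that show ?thesis by simp
  qed (use s in auto)
  moreover have "R ((step P ^^ (s' + s)) c)"
    using s'(2) by (simp add: funpow_add)
  ultimately show ?thesis
    unfolding runs_def using s(1) s'(1) by (intro exI[of _ "s' + s"]) auto
qed

lemma all_upd_less [simp]:
  "\<forall>i. r i < (W::nat) \<Longrightarrow> (\<forall>i. (r(d := v)) i < W) \<longleftrightarrow> v < W"
  by auto

section \<open>The program\<close>

text \<open>Cell \<open>L + i\<close>, for a tree of \<open>L\<close> cells, holds the value of the feature with index \<open>i\<close>: 0 if it is
  free, otherwise the value plus 1. The stack starts at \<open>L + N\<close>, for \<open>N\<close> features. It contains the nodes
  on the current path at which both children have to be visited, and the leaf of the outer traversal at
  which the inner one was started. Whether the first or the second child of a node on the stack has just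
  been completed is read off the recorded value of its feature.

  Registers: 0 is the running total, 1 the address of the value of \<open>x\<close>, 2 is \<open>L\<close>, 3 the number of free
  features, 4 the stack pointer, 5 the current node, 6 tells the inner traversal (1) from the outer one
  (0), 7 is the label of the outer leaf (0 in the outer traversal), 8, 9 and 10 contain the constants 1,
  2 and 5, and 12 is the bottom of the stack. The others are scratch. Jump targets are absolute; the
  number in a comment is the address of the instruction that follows it.\<close>

definition prog :: "instr list" where
  "prog =
    [
     \<comment> \<open>0: set up the registers\<close>
     Add 4 2 0, Add 12 2 0, Const 8 1, Sub 3 0 8, Const 0 0, Add 1 2 1,
     Store 1 8, Const 9 2, Const 10 5,
     \<comment> \<open>9: visit the node in register 5\<close>
     Load 13 5, JumpZero 13 37, Add 14 5 8, Load 15 14, Add 15 2 15, Load 16 15,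
     JumpZero 16 22, Add 14 14 16, Load 17 14,
     \<comment> \<open>18: move to a child\<close>
     Add 14 5 10, Sub 14 14 17, Load 5 14, Jump 9,
     \<comment> \<open>22: visit, feature unassigned\<close>
     Add 14 5 9, Load 17 14, Add 14 14 8, Load 18 14, Sub 19 17 18, Sub 20 18 17,
     Add 19 19 20, JumpZero 19 18, Add 18 18 8, Store 15 18, Sub 3 3 8, Store 4 5,
     Add 4 4 8, Const 17 1, Jump 18,
     \<comment> \<open>37: visit, leaf\<close>
     Add 14 5 8, Load 13 14, JumpZero 6 47, Sub 14 13 7, Sub 15 7 13, Add 14 14 15,
     JumpZero 14 54, Shl 15 8 3, Add 0 0 15, Jump 54,
     \<comment> \<open>47: visit, leaf of the outer traversal\<close>
     Add 7 13 6, Store 4 5, Add 4 4 8, Const 6 1, Store 1 9, Const 5 0,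
     Jump 9,
     \<comment> \<open>54: return\<close>
     Sub 13 4 12, JumpZero 13 85, Sub 4 4 8, Load 5 4, Load 13 5, JumpZero 13 81,
     Add 14 5 8, Load 15 14, Add 15 2 15, Load 16 15, Add 14 14 9, Load 17 14,
     Add 17 17 8, Sub 18 16 17, Sub 19 17 16, Add 18 18 19, JumpZero 18 75, Const 18 0,
     Store 15 18, Add 3 3 8, Jump 54,
     \<comment> \<open>75: return, second child pending\<close>
     Const 18 3, Sub 18 18 16, Store 15 18, Add 4 4 8, Const 17 0, Jump 18,
     \<comment> \<open>81: return from the inner traversal\<close>
     Const 6 0, Const 7 0, Store 1 8, Jump 54,
     \<comment> \<open>85: double the total and halt\<close>
     Add 0 0 0]"

lemma length_prog [simp]: "length prog = 86"
  by (simp add: prog_def)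

lemma prog_nth:
  "prog ! 0 = Add 4 2 0" "prog ! Suc 0 = Add 12 2 0" "prog ! 2 = Const 8 1"
  "prog ! 3 = Sub 3 0 8" "prog ! 4 = Const 0 0" "prog ! 5 = Add 1 2 1"
  "prog ! 6 = Store 1 8" "prog ! 7 = Const 9 2" "prog ! 8 = Const 10 5"
  "prog ! 9 = Load 13 5" "prog ! 10 = JumpZero 13 37" "prog ! 11 = Add 14 5 8"
  "prog ! 12 = Load 15 14" "prog ! 13 = Add 15 2 15" "prog ! 14 = Load 16 15"
  "prog ! 15 = JumpZero 16 22" "prog ! 16 = Add 14 14 16" "prog ! 17 = Load 17 14"
  "prog ! 18 = Add 14 5 10" "prog ! 19 = Sub 14 14 17" "prog ! 20 = Load 5 14"
  "prog ! 21 = Jump 9" "prog ! 22 = Add 14 5 9" "prog ! 23 = Load 17 14"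
  "prog ! 24 = Add 14 14 8" "prog ! 25 = Load 18 14" "prog ! 26 = Sub 19 17 18"
  "prog ! 27 = Sub 20 18 17" "prog ! 28 = Add 19 19 20" "prog ! 29 = JumpZero 19 18"
  "prog ! 30 = Add 18 18 8" "prog ! 31 = Store 15 18" "prog ! 32 = Sub 3 3 8"
  "prog ! 33 = Store 4 5" "prog ! 34 = Add 4 4 8" "prog ! 35 = Const 17 1"
  "prog ! 36 = Jump 18" "prog ! 37 = Add 14 5 8" "prog ! 38 = Load 13 14"
  "prog ! 39 = JumpZero 6 47" "prog ! 40 = Sub 14 13 7" "prog ! 41 = Sub 15 7 13"
  "prog ! 42 = Add 14 14 15" "prog ! 43 = JumpZero 14 54" "prog ! 44 = Shl 15 8 3"
  "prog ! 45 = Add 0 0 15" "prog ! 46 = Jump 54" "prog ! 47 = Add 7 13 6"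
  "prog ! 48 = Store 4 5" "prog ! 49 = Add 4 4 8" "prog ! 50 = Const 6 1"
  "prog ! 51 = Store 1 9" "prog ! 52 = Const 5 0" "prog ! 53 = Jump 9"
  "prog ! 54 = Sub 13 4 12" "prog ! 55 = JumpZero 13 85" "prog ! 56 = Sub 4 4 8"
  "prog ! 57 = Load 5 4" "prog ! 58 = Load 13 5" "prog ! 59 = JumpZero 13 81"
  "prog ! 60 = Add 14 5 8" "prog ! 61 = Load 15 14" "prog ! 62 = Add 15 2 15"
  "prog ! 63 = Load 16 15" "prog ! 64 = Add 14 14 9" "prog ! 65 = Load 17 14"
  "prog ! 66 = Add 17 17 8" "prog ! 67 = Sub 18 16 17" "prog ! 68 = Sub 19 17 16"
  "prog ! 69 = Add 18 18 19" "prog ! 70 = JumpZero 18 75" "prog ! 71 = Const 18 0"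
  "prog ! 72 = Store 15 18" "prog ! 73 = Add 3 3 8" "prog ! 74 = Jump 54"
  "prog ! 75 = Const 18 3" "prog ! 76 = Sub 18 18 16" "prog ! 77 = Store 15 18"
  "prog ! 78 = Add 4 4 8" "prog ! 79 = Const 17 0" "prog ! 80 = Jump 18"
  "prog ! 81 = Const 6 0" "prog ! 82 = Const 7 0" "prog ! 83 = Store 1 8"
  "prog ! 84 = Jump 54" "prog ! 85 = Add 0 0 0"
  by (simp_all add: prog_def)

abbreviation (input) "visit_pc \<equiv> 9 :: nat"
abbreviation (input) "return_pc \<equiv> 54 :: nat"

fun cell_of :: "bool option \<Rightarrow> nat" where
  "cell_of None = 0"
| "cell_of (Some False) = 1"
| "cell_of (Some True) = 2"

text \<open>\<open>m0\<close> is the initial memory, \<open>H\<close> a bound for the height of the stack.\<close>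

locale machine =
  fixes X :: "'a set" and x :: 'a and idx :: "'a \<Rightarrow> nat"
    and m0 :: "nat \<Rightarrow> nat" and L N H W :: nat
  assumes fin: "finite X" and idx_inj: "inj_on idx X"
    and idx_less: "y \<in> X \<Longrightarrow> idx y < N" and x_in: "x \<in> X"
    and W_large: "L + N + H + 10 < W" and W_power: "2 ^ N < W" and m0_less: "m0 i < W"
begin

text \<open>The scratch registers and the memory above the stack are only bounded, so popping needs
  no cleanup. The counter \<open>k\<close> is not tied to \<open>\<sigma>\<close> here; the
  traversal lemmas carry the link \<open>card (completions X \<sigma>) = 2 ^ k\<close>.\<close>

definition represents :: "nat \<Rightarrow> nat \<Rightarrow> nat list \<Rightarrow> nat \<Rightarrow> nat \<Rightarrow> ('a \<Rightarrow> bool option) \<Rightarrow> nat \<Rightarrow>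
    (nat \<Rightarrow> nat) \<Rightarrow> (nat \<Rightarrow> nat) \<Rightarrow> bool" where
  "represents A k st f b \<sigma> a r m \<longleftrightarrow> (\<forall>i. r i < W) \<and> (\<forall>i. m i < W) \<and>
     r 0 = A \<and> r (Suc 0) = L + idx x \<and> r 2 = L \<and> r 3 = k \<and> r 4 = L + N + length st \<and> r 5 = a \<and>
     r 6 = f \<and> r 7 = b \<and> r 8 = 1 \<and> r 9 = 2 \<and> r 10 = 5 \<and> r 12 = L + N \<and>
     (\<forall>i<L. m i = m0 i) \<and> (\<forall>y\<in>X. m (L + idx y) = cell_of (\<sigma> y)) \<and>
     (\<forall>i<length st. m (L + N + i) = st ! i)"

definition state_at :: "nat \<Rightarrow> nat \<Rightarrow> nat \<Rightarrow> nat list \<Rightarrow> nat \<Rightarrow> nat \<Rightarrow> ('a \<Rightarrow> bool option) \<Rightarrow> nat \<Rightarrow> config \<Rightarrow> bool"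
  where
  "state_at q A k st f b \<sigma> a c \<longleftrightarrow> (\<exists>r m. c = (q, r, m) \<and> represents A k st f b \<sigma> a r m)"

text \<open>The addresses are spelled as the simplifier leaves them when it executes the program.\<close>

fun stored :: "nat \<Rightarrow> 'a dtree \<Rightarrow> bool" where
  "stored a (Leaf c) \<longleftrightarrow> a + 1 < L \<and> m0 a = 0 \<and> m0 (a + 1) = of_bool c"
| "stored a (Node y p l r) \<longleftrightarrow> a + 5 < L \<and> m0 a = 1 \<and> m0 (a + 1) = idx y \<and>
     m0 (a + 2) = of_bool (p False) \<and> m0 (Suc (Suc (Suc a))) = of_bool (p True) \<and>
     stored (m0 (4 + a)) l \<and> stored (m0 (a + 5)) r"

section \<open>Symbolic execution of the program segments\<close>

text \<open>The cell of \<open>y\<close> holds the value plus 1; adding this to \<open>a + 1\<close>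
  gives the address of the truth table entry for \<open>v\<close>. Subtracting that entry from
  \<open>a + 5\<close> gives the address of the child pointer.\<close>

lemma visit_assigned:
  assumes S: "state_at visit_pc A k st f b \<sigma> a c" and t: "stored a (Node y p l r')" and y: "y \<in> X"
    and v: "\<sigma> y = Some v"
  shows "runs prog W 13 c (state_at visit_pc A k st f b \<sigma> (m0 (if p v then 4 + a else a + 5)))"
proof -
  from S obtain r m where c: "c = (visit_pc, r, m)" and ok: "represents A k st f b \<sigma> a r m"
    unfolding state_at_def by blast
  note R = m0_less ok[unfolded represents_def] y
  \<comment> \<open>The case split makes every branch condition concrete. The budget is the exact
    number of instructions executed, so the repetition of \<open>runs_step\<close> stops at the
    right place, where \<open>0 < t\<close> fails. The lemmas below work in the same way.\<close>
  show ?thesis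
    unfolding c using idx_less[OF y] W_large t v
    by (cases v; cases "p v", simp_all)
     ((rule runs_step, simp, simp add: R, (simp; fail), simp add: R prog_nth)+,
      rule runs_done, simp add: R, simp add: state_at_def represents_def R)+
qed

text \<open>The two table entries are compared through the sum of both truncated differences, which
  is zero iff they are equal. Nothing is pushed, so a later return passes over this node.\<close>

lemma visit_const:
  assumes S: "state_at visit_pc A k st f b \<sigma> a c" and t: "stored a (Node y p l r')" and y: "y \<in> X"
    and v: "\<sigma> y = None" and p: "p True = p False"
  shows "runs prog W 19 c (state_at visit_pc A k st f b \<sigma> (m0 (if p True then 4 + a else a + 5)))"
proof -
  from S obtain r m where c: "c = (visit_pc, r, m)" and ok: "represents A k st f b \<sigma> a r m"
    unfolding state_at_def by blast
  note R = m0_less ok[unfolded represents_def] y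
  show ?thesis
    unfolding c using idx_less[OF y] W_large t v p
    by (cases "p True", simp_all)
     ((rule runs_step, simp, simp add: R, (simp; fail), simp add: R prog_nth)+,
      rule runs_done, simp add: R, simp add: state_at_def represents_def R)+
qed

lemmas frame = inj_on_eq_iff[OF idx_inj] nth_append less_Suc_eq

text \<open>A nonconstant test is the identity or the negation, and in both cases
  \<open>p True\<close> is the value that satisfies it. Recording this value therefore matches
  entering the left child first.\<close>

lemma visit_split:
  assumes S: "state_at visit_pc A k st f b \<sigma> a c" and t: "stored a (Node y p l r')" and y: "y \<in> X"
    and v: "\<sigma> y = None" and p: "p True \<noteq> p False" and H: "length st < H"
  shows "runs prog W 26 c
    (state_at visit_pc A (k - 1) (st @ [a]) f b (\<sigma>(y := Some (p True))) (m0 (4 + a)))"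
proof -
  from S obtain r m where c: "c = (visit_pc, r, m)" and ok: "represents A k st f b \<sigma> a r m"
    unfolding state_at_def by blast
  note R = m0_less ok[unfolded represents_def] y
  have "k < W" using ok by (auto simp: represents_def)
  then show ?thesis
    unfolding c using idx_less[OF y] W_large t v p H
    by (cases "p True", simp_all)
     ((rule runs_step, simp, simp add: R, (simp; fail), simp add: R prog_nth)+,
      rule runs_done, simp add: R, auto simp: state_at_def represents_def R frame dest: idx_less)+
qed

text \<open>The recorded value is still \<open>p True\<close>, so the right child is pending.
  Subtracting the cell from 3 swaps the codes 1 and 2, and raising the stack pointer again restores
  the popped entry.\<close>

lemma return_first:
  assumes S: "state_at return_pc A k (st @ [a]) f b \<sigma> a' c" and t: "stored a (Node y p l r')" and y: "y \<in> X"
    and v: "\<sigma> y = Some (p True)" and p: "p True \<noteq> p False" and H: "length st < H"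
  shows "runs prog W 27 c
    (state_at visit_pc A k (st @ [a]) f b (\<sigma>(y := Some (\<not> p True))) (m0 (a + 5)))"
proof -
  from S obtain r m where c: "c = (return_pc, r, m)" and ok: "represents A k (st @ [a]) f b \<sigma> a' r m"
    unfolding state_at_def by blast
  note R = m0_less ok[unfolded represents_def] y
  show ?thesis
    unfolding c using idx_less[OF y] W_large t v p H
    by (cases "p True", simp_all)
     ((rule runs_step, simp, simp add: R, (simp; fail), simp add: R prog_nth)+,
      rule runs_done, simp add: R, auto simp: state_at_def represents_def R frame dest: idx_less)+
qed

text \<open>The recorded value differs from \<open>p True\<close>, which shows that both children
  are done; the feature becomes free again.\<close>

lemma return_second:
  assumes S: "state_at return_pc A k (st @ [a]) f b \<sigma> a' c" and t: "stored a (Node y p l r')" and y: "y \<in> X"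
    and v: "\<sigma> y = Some (\<not> p True)" and p: "p True \<noteq> p False" and H: "length st < H"
    and k: "k + 1 < W"
  shows "runs prog W 21 c (state_at return_pc A (k + 1) st f b (\<sigma>(y := None)) a)"
proof -
  from S obtain r m where c: "c = (return_pc, r, m)" and ok: "represents A k (st @ [a]) f b \<sigma> a' r m"
    unfolding state_at_def by blast
  note R = m0_less ok[unfolded represents_def] y
  show ?thesis
    unfolding c using idx_less[OF y] W_large t v p H k
    by (cases "p True", simp_all)
     ((rule runs_step, simp, simp add: R, (simp; fail), simp add: R prog_nth)+,
      rule runs_done, simp add: R, auto simp: state_at_def represents_def R frame dest: idx_less)+
qed

lemma inner_leaf_differs:
  assumes S: "state_at visit_pc A k st 1 (of_bool (\<not> d)) \<sigma> a c" and t: "stored a (Leaf d)"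
    and A: "A + 2 ^ k < W"
  shows "runs prog W 12 c (state_at return_pc (A + 2 ^ k) k st 1 (of_bool (\<not> d)) \<sigma> a)"
proof -
  from S obtain r m where c: "c = (visit_pc, r, m)" and ok: "represents A k st 1 (of_bool (\<not> d)) \<sigma> a r m"
    unfolding state_at_def by blast
  note R = m0_less ok[unfolded represents_def]
  have "2 ^ k < W" "k < W" using A less_exp[of k] by linarith+
  then show ?thesis
    unfolding c using W_large t A
    by (cases d, simp_all)
     ((rule runs_step, simp, simp add: R, (simp; fail), simp add: R prog_nth)+,
      rule runs_done, simp add: R, auto simp: state_at_def represents_def R frame dest: idx_less)+
qed

lemma inner_leaf_agrees:
  assumes S: "state_at visit_pc A k st 1 (of_bool d) \<sigma> a c" and t: "stored a (Leaf d)"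
  shows "runs prog W 9 c (state_at return_pc A k st 1 (of_bool d) \<sigma> a)"
proof -
  from S obtain r m where c: "c = (visit_pc, r, m)" and ok: "represents A k st 1 (of_bool d) \<sigma> a r m"
    unfolding state_at_def by blast
  note R = m0_less ok[unfolded represents_def]
  show ?thesis
    unfolding c using W_large t
    by (cases d, simp_all)
     ((rule runs_step, simp, simp add: R, (simp; fail), simp add: R prog_nth)+,
      rule runs_done, simp add: R, auto simp: state_at_def represents_def R frame dest: idx_less)+
qed

text \<open>The pushed leaf marks the change of phase. The feature \<open>x\<close> is fixed before
  and after, so \<open>k\<close> stays the same; the inner traversal restarts at the root, address
  0.\<close>

lemma outer_leaf:
  assumes S: "state_at visit_pc A k st 0 0 \<sigma> a c" and t: "stored a (Leaf d)" and H: "length st < H"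
  shows "runs prog W 12 c (state_at visit_pc A k (st @ [a]) 1 (of_bool d) (\<sigma>(x := Some True)) 0)"
proof -
  from S obtain r m where c: "c = (visit_pc, r, m)" and ok: "represents A k st 0 0 \<sigma> a r m"
    unfolding state_at_def by blast
  note R = m0_less ok[unfolded represents_def] x_in
  show ?thesis
    unfolding c using W_large t H idx_less[OF x_in]
    by (cases d, simp_all)
     ((rule runs_step, simp, simp add: R, (simp; fail), simp add: R prog_nth)+,
      rule runs_done, simp add: R, auto simp: state_at_def represents_def R frame dest: idx_less)+
qed

text \<open>Tag 0 of the popped node distinguishes the phase marker from the internal nodes on the
  stack.\<close>

lemma return_phase:
  assumes S: "state_at return_pc A k (st @ [a]) 1 b \<sigma> a' c" and t: "stored a (Leaf d)" and H: "length st < H"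
  shows "runs prog W 10 c (state_at return_pc A k st 0 0 (\<sigma>(x := Some False)) a)"
proof -
  from S obtain r m where c: "c = (return_pc, r, m)" and ok: "represents A k (st @ [a]) 1 b \<sigma> a' r m"
    unfolding state_at_def by blast
  note R = m0_less ok[unfolded represents_def] x_in
  show ?thesis
    unfolding c using W_large t H idx_less[OF x_in]
    by (cases d, simp_all)
     ((rule runs_step, simp, simp add: R, (simp; fail), simp add: R prog_nth)+,
      rule runs_done, simp add: R, auto simp: state_at_def represents_def R frame dest: idx_less)+
qed

text \<open>Zeroed memory means that all features are free; fixing \<open>x\<close> to
  \<open>False\<close> leaves \<open>N - 1\<close> of them.\<close>

lemma start:
  assumes r: "r = (\<lambda>_. 0)(0 := N, 1 := idx x, 2 := L)" and m: "\<And>q. m q < W"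
    "\<And>q. q < L \<Longrightarrow> m q = m0 q" "\<And>q. q \<ge> L \<Longrightarrow> m q = 0"
  shows "runs prog W 9 (0, r, m) (state_at visit_pc 0 (N - 1) [] 0 0 [x \<mapsto> False] 0)"
proof -
  note R = numeral_2_eq_2[symmetric] m0_less m r x_in
  show ?thesis
    by (insert W_large idx_less[OF x_in], simp)
     ((rule runs_step, simp, simp add: R, (simp; fail), simp add: R prog_nth)+,
      rule runs_done, simp add: R, auto simp: state_at_def represents_def R frame dest: idx_less)
qed

lemma finish:
  assumes S: "state_at return_pc A k [] f b \<sigma> a c" and A: "A + A < W"
  shows "runs prog W 3 c (\<lambda>c. fst c = length prog \<and> fst (snd c) 0 = A + A)"
proof -
  from S obtain r m where c: "c = (return_pc, r, m)" and ok: "represents A k [] f b \<sigma> a r m"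
    unfolding state_at_def by blast
  note R = m0_less ok[unfolded represents_def]
  show ?thesis
    unfolding c
    by (insert W_large A)
     ((rule runs_step, simp, simp add: R, (simp; fail), simp add: R prog_nth)+,
      rule runs_done, simp add: R, auto simp: R)
qed

section \<open>Traversals\<close>

text \<open>Common to both traversals, which differ in the action \<open>leaf\<close> of cost
  \<open>\<tau>\<close>. The constant 74 is 26 + 27 + 21, the cost of entering a splitting node,
  switching to its second child and leaving it. The bound \<open>M\<close> limits the stack height
  at leaves, and \<open>A + 2 ^ k \<le> 2 ^ N\<close> keeps the total small.\<close>

lemma visit_tree:
  assumes leaf: "\<And>A k st \<sigma> a d c. state_at visit_pc A k st f b \<sigma> a c \<Longrightarrow> stored a (Leaf d) \<Longrightarrow>
      length st < M \<Longrightarrow> \<sigma> x = Some s \<Longrightarrow> card (completions X \<sigma>) = 2 ^ k \<Longrightarrow> A + 2 ^ k \<le> 2 ^ N \<Longrightarrow>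
      runs prog W \<tau> c (\<lambda>c'. \<exists>a'. state_at return_pc
        (A + card {e \<in> completions X \<sigma>. Q e d}) k st f b \<sigma> a' c')"
    and M: "M \<le> H"
  shows "state_at visit_pc A k st f b \<sigma> a c \<Longrightarrow> stored a t \<Longrightarrow> features t \<subseteq> X \<Longrightarrow>
      length st + nodes t \<le> M \<Longrightarrow> \<sigma> x = Some s \<Longrightarrow> card (completions X \<sigma>) = 2 ^ k \<Longrightarrow>
      A + 2 ^ k \<le> 2 ^ N \<Longrightarrow>
      runs prog W ((\<tau> + 74) * nodes t) c (\<lambda>c'. \<exists>a'. state_at return_pc
        (A + card {e \<in> completions X \<sigma>. Q e (classify t e)}) k st f b \<sigma> a' c')"
proof (induction t arbitrary: A k st \<sigma> a c)
  case (Leaf d)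
  have "runs prog W \<tau> c (\<lambda>c'. \<exists>a'. state_at return_pc
      (A + card {e \<in> completions X \<sigma>. Q e d}) k st f b \<sigma> a' c')"
    using Leaf.prems by (intro leaf) auto
  then show ?case by (rule runs_mono) simp_all
next
  case (Node y p l r)
  let ?P = "\<lambda>t A k st \<sigma> c'. \<exists>a'. state_at return_pc
      (A + card {e \<in> completions X \<sigma>. Q e (classify t e)}) k st f b \<sigma> a' c'"
  have y: "y \<in> X" and sub: "features l \<subseteq> X" "features r \<subseteq> X"
    and nodes: "length st + nodes l \<le> M" "length st + nodes r \<le> M"
    "Suc (length st) + nodes l \<le> M" "Suc (length st) + nodes r \<le> M"
    and stored: "stored (m0 (4 + a)) l" "stored (m0 (a + 5)) r"
    using Node.prems by auto
  have len: "length st < H"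
    using nodes(3) M by linarith
  \<comment> \<open>If the test has the same outcome on all completions, one child is entered with
    \<open>\<sigma>\<close> and the stack unchanged. The budget 19 covers both an assigned feature
    and a constant test.\<close>
  have visit_child: "runs prog W ((\<tau> + 74) * nodes (Node y p l r)) c (?P (Node y p l r) A k st \<sigma>)"
    if run: "runs prog W 19 c (state_at visit_pc A k st f b \<sigma> (m0 (if q then 4 + a else a + 5)))"
      and q: "\<And>e. e \<in> completions X \<sigma> \<Longrightarrow> p (e y) = q" for q
  proof -
    let ?t = "if q then l else r"
    have "runs prog W ((\<tau> + 74) * nodes ?t) c' (?P ?t A k st \<sigma>)"
      if "state_at visit_pc A k st f b \<sigma> (m0 (if q then 4 + a else a + 5)) c'" for c'
      using that Node.IH(1)[of A k st \<sigma> "m0 (4 + a)" c'] Node.IH(2)[of A k st \<sigma> "m0 (a + 5)" c']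
        Node.prems stored nodes sub by (cases q) simp_all
    with run have "runs prog W (19 + (\<tau> + 74) * nodes ?t) c (?P ?t A k st \<sigma>)"
      by (rule runs_trans)
    moreover have "{e \<in> completions X \<sigma>. Q e (classify ?t e)} =
        {e \<in> completions X \<sigma>. Q e (classify (Node y p l r) e)}"
      using q by (intro Collect_cong) auto
    ultimately have "runs prog W (19 + (\<tau> + 74) * nodes ?t) c (?P (Node y p l r) A k st \<sigma>)"
      by (simp only:)
    then show ?thesis
      by (rule runs_mono) (simp_all add: algebra_simps)
  qed
  show ?case
  proof (cases "\<sigma> y")
    case (Some v)
    have "runs prog W 19 c (state_at visit_pc A k st f b \<sigma> (m0 (if p v then 4 + a else a + 5)))"
      by (rule runs_mono[OF visit_assigned[OF Node.prems(1,2) y Some]]) simp_all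
    then show ?thesis
      by (rule visit_child) (simp add: completions_value[where \<sigma> = \<sigma>, OF _ y Some])
  next
    case None
    show ?thesis
    proof (cases "p True = p False")
      case True
      have "p v = p True" for v
        using True by (cases v) simp_all
      with visit_const[OF Node.prems(1,2) y None True] show ?thesis
        by (intro visit_child)
    next
      case False
      let ?u = "p True"
      let ?\<sigma>1 = "\<sigma>(y := Some ?u)" and ?\<sigma>2 = "\<sigma>(y := Some (\<not> ?u))"
      let ?st = "st @ [a]"
      define B where "B = card {e \<in> completions X ?\<sigma>1. Q e (classify l e)}"
      define C where "C = card {e \<in> completions X ?\<sigma>2. Q e (classify r e)}"
      have p: "p ?u" "\<not> p (\<not> ?u)"
        using False by (cases "p True"; simp)+
      \<comment> \<open>The feature \<open>x\<close> is always assigned, so a split never touches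
        it.\<close>
      have xy: "x \<noteq> y"
        using None Node.prems(5) by auto
      have half: "card (completions X \<sigma>) = 2 * card (completions X (\<sigma>(y := Some v)))" for v
        by (rule card_completions_half[where \<sigma> = \<sigma>, OF fin y None])
      \<comment> \<open>The cardinality is even, whereas \<open>2 ^ 0\<close> is odd.\<close>
      then have "k \<noteq> 0"
        using Node.prems(6) by (metis dvd_triv_left odd_one power_0)
      then obtain j where k: "k = Suc j"
        by (cases k) auto
      have card: "card (completions X (\<sigma>(y := Some v))) = 2 ^ j" for v
        using half[of v] Node.prems(6) k by simp
      \<comment> \<open>Gives \<open>A + B + 2 ^ j \<le> 2 ^ N\<close>, the bound that the induction
        hypothesis for the right child requires.\<close>
      have B: "B \<le> 2 ^ j"
        using card_mono[OF finite_completions[OF fin], of "{e \<in> completions X ?\<sigma>1. Q e (classify l e)}" ?\<sigma>1]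
        unfolding B_def card by blast
      have split: "card {e \<in> completions X \<sigma>. Q e (classify (Node y p l r) e)} = B + C"
      proof -
        have l: "p (e y)" if "e \<in> completions X ?\<sigma>1" for e
          using completions_value[OF that y, of ?u] p(1) by simp
        have r: "\<not> p (e y)" if "e \<in> completions X ?\<sigma>2" for e
          using completions_value[OF that y, of "\<not> ?u"] p(2) by simp
        have "{e \<in> completions X ?\<sigma>1. Q e (classify (Node y p l r) e)} =
            {e \<in> completions X ?\<sigma>1. Q e (classify l e)}"
          by (rule Collect_cong) (auto dest: l)
        moreover have "{e \<in> completions X ?\<sigma>2. Q e (classify (Node y p l r) e)} =
            {e \<in> completions X ?\<sigma>2. Q e (classify r e)}"
          by (rule Collect_cong) (auto dest: r)
        ultimately show ?thesis
          unfolding B_def C_def card_completions_split[of X y \<sigma> _ ?u, OF fin y None] by (simp only:)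
      qed
      have j: "j + 1 < W"
        using Node.prems(7) W_power less_exp[of k] unfolding k by linarith
      have "runs prog W 26 c (state_at visit_pc A j ?st f b ?\<sigma>1 (m0 (4 + a)))"
        using visit_split[OF Node.prems(1,2) y None False len] k by simp
      moreover have "runs prog W ((\<tau> + 74) * nodes l) c' (?P l A j ?st ?\<sigma>1)"
        if "state_at visit_pc A j ?st f b ?\<sigma>1 (m0 (4 + a)) c'" for c'
        using that stored(1) sub(1)
        by (rule Node.IH(1))
          (use nodes Node.prems(5,7) xy k card in \<open>simp_all add: fun_upd_other del: fun_upd_apply\<close>)
      ultimately have "runs prog W (26 + (\<tau> + 74) * nodes l) c (?P l A j ?st ?\<sigma>1)"
        by (rule runs_trans)
      moreover have "runs prog W 27 c' (state_at visit_pc (A + B) j ?st f b ?\<sigma>2 (m0 (a + 5)))"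
        if "?P l A j ?st ?\<sigma>1 c'" for c'
        using that return_first[OF _ Node.prems(2) y _ False len, of "A + B" j f b ?\<sigma>1 _ c']
        unfolding B_def by auto
      ultimately have "runs prog W (26 + (\<tau> + 74) * nodes l + 27) c
          (state_at visit_pc (A + B) j ?st f b ?\<sigma>2 (m0 (a + 5)))"
        by (rule runs_trans)
      moreover have "runs prog W ((\<tau> + 74) * nodes r) c' (?P r (A + B) j ?st ?\<sigma>2)"
        if "state_at visit_pc (A + B) j ?st f b ?\<sigma>2 (m0 (a + 5)) c'" for c'
        using that stored(2) sub(2)
        by (rule Node.IH(2))
          (use nodes Node.prems(5,7) xy k card B in \<open>simp_all add: fun_upd_other del: fun_upd_apply\<close>)
      ultimately have "runs prog W (26 + (\<tau> + 74) * nodes l + 27 + (\<tau> + 74) * nodes r) c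
          (?P r (A + B) j ?st ?\<sigma>2)"
        by (rule runs_trans)
      moreover have "runs prog W 21 c' (?P (Node y p l r) A k st \<sigma>)"
        if "?P r (A + B) j ?st ?\<sigma>2 c'" for c'
      proof -
        from that obtain a' where "state_at return_pc (A + B + C) j ?st f b ?\<sigma>2 a' c'"
          unfolding C_def by blast
        then have "runs prog W 21 c'
            (state_at return_pc (A + B + C) (j + 1) st f b (?\<sigma>2(y := None)) a)"
          by (rule return_second[OF _ Node.prems(2) y _ False len j]) simp
        moreover have "?\<sigma>2(y := None) = \<sigma>"
          using None by auto
        moreover have "A + B + C = A + card {e \<in> completions X \<sigma>. Q e (classify (Node y p l r) e)}"
          using split by simp
        ultimately have "runs prog W 21 c' (state_at return_pc
            (A + card {e \<in> completions X \<sigma>. Q e (classify (Node y p l r) e)}) k st f b \<sigma> a)"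
          unfolding k by (simp only: Suc_eq_plus1)
        then show ?thesis
          by (rule runs_mono) blast+
      qed
      ultimately have "runs prog W (26 + (\<tau> + 74) * nodes l + 27 + (\<tau> + 74) * nodes r + 21) c
          (?P (Node y p l r) A k st \<sigma>)"
        by (rule runs_trans)
      then show ?thesis
        by (rule runs_mono) (simp_all add: algebra_simps)
    qed
  qed
qed

text \<open>A leaf adds the whole subcube, \<open>2 ^ k\<close> entities, if its label differs from
  \<open>u\<close>, and nothing otherwise; 12 steps cover both cases.\<close>

lemma visit_inner:
  assumes "state_at visit_pc A k st 1 (of_bool u) \<sigma> a c" "stored a t" "features t \<subseteq> X"
    "length st + nodes t \<le> H" "\<sigma> x = Some True" "card (completions X \<sigma>) = 2 ^ k" "A + 2 ^ k \<le> 2 ^ N"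
  shows "runs prog W (86 * nodes t) c (\<lambda>c'. \<exists>a'. state_at return_pc
    (A + card {e \<in> completions X \<sigma>. u \<noteq> classify t e}) k st 1 (of_bool u) \<sigma> a' c')"
proof -
  have "runs prog W ((12 + 74) * nodes t) c (\<lambda>c'. \<exists>a'. state_at return_pc
    (A + card {e \<in> completions X \<sigma>. u \<noteq> classify t e}) k st 1 (of_bool u) \<sigma> a' c')"
  proof (rule visit_tree[OF _ order_refl assms])
    fix A k st \<sigma> a d c
    assume *: "state_at visit_pc A k st 1 (of_bool u) \<sigma> a c" "stored a (Leaf d)"
      and card: "card (completions X \<sigma>) = 2 ^ k" and A: "A + 2 ^ k \<le> 2 ^ N"
    show "runs prog W 12 c (\<lambda>c'. \<exists>a'. state_at return_pc
        (A + card {e \<in> completions X \<sigma>. u \<noteq> d}) k st 1 (of_bool u) \<sigma> a' c')"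
    proof (cases "u = d")
      case True
      then have "runs prog W 9 c (state_at return_pc A k st 1 (of_bool u) \<sigma> a)"
        using * inner_leaf_agrees by blast
      then show ?thesis
        by (rule runs_mono) (use True in auto)
    next
      case False
      then have u: "u = (\<not> d)" by blast
      have "A + 2 ^ k < W"
        using A W_power by linarith
      then have "runs prog W 12 c (state_at return_pc (A + 2 ^ k) k st 1 (of_bool u) \<sigma> a)"
        using * inner_leaf_differs unfolding u by blast
      then show ?thesis
        by (rule runs_mono) (use False card in auto)
    qed
  qed
  then show ?thesis by simp
qed

text \<open>Here the leaf action is a complete inner traversal between a phase change of 12 steps
  and one of 10, which makes the cost quadratic; 96 is 12 + 10 + 74.\<close>

lemma visit_outer:
  assumes T: "stored 0 T" "features T \<subseteq> X" "2 * nodes T \<le> H"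
    and start: "state_at visit_pc A k [] 0 0 \<sigma> 0 c" "\<sigma> x = Some False"
      "card (completions X \<sigma>) = 2 ^ k" "A + 2 ^ k \<le> 2 ^ N"
  shows "runs prog W ((86 * nodes T + 96) * nodes T) c (\<lambda>c'. \<exists>a'. state_at return_pc
    (A + card {e \<in> completions X \<sigma>. classify T e \<noteq> classify T (e(x := True))}) k [] 0 0 \<sigma> a' c')"
proof -
  have "runs prog W ((12 + 86 * nodes T + 10 + 74) * nodes T) c (\<lambda>c'. \<exists>a'. state_at return_pc
    (A + card {e \<in> completions X \<sigma>. classify T e \<noteq> classify T (e(x := True))}) k [] 0 0 \<sigma> a' c')"
  proof (rule visit_tree[OF _ _ start(1) T(1,2) _ start(2-4)])
    show "nodes T \<le> H" "length [] + nodes T \<le> nodes T"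
      using T(3) by simp_all
    fix A k and st :: "nat list" and \<sigma> a d c
    assume S: "state_at visit_pc A k st 0 0 \<sigma> a c" and d: "stored a (Leaf d)"
      and st: "length st < nodes T" and x: "\<sigma> x = Some False"
      and card: "card (completions X \<sigma>) = 2 ^ k" and A: "A + 2 ^ k \<le> 2 ^ N"
    let ?\<sigma> = "\<sigma>(x := Some True)" and ?st = "st @ [a]"
    have \<sigma>: "?\<sigma>(x := Some False) = \<sigma>" "\<sigma>(x := Some False) = \<sigma>"
      using x by auto
    \<comment> \<open>The inner traversal counts on the face \<open>x = 1\<close>; its count is
      carried back to \<open>\<sigma>\<close>.\<close>
    have card': "card {e \<in> completions X ?\<sigma>. Q e} = card {e \<in> completions X \<sigma>. Q (e(x := True))}" for Q
      using card_completions_upd[OF x_in, of \<sigma> False Q True] unfolding \<sigma> by simp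
    \<comment> \<open>Fewer than \<open>nodes T\<close> outer entries, one marker and at most
      \<open>nodes T\<close> inner entries fit into \<open>2 * nodes T\<close>.\<close>
    have st': "length st < H" "length ?st + nodes T \<le> H"
      using st T(3) by simp_all
    have "runs prog W 12 c (state_at visit_pc A k ?st 1 (of_bool d) ?\<sigma> 0)"
      by (rule outer_leaf[OF S d st'(1)])
    moreover have "runs prog W (86 * nodes T) c' (\<lambda>c'. \<exists>a'. state_at return_pc
        (A + card {e \<in> completions X ?\<sigma>. d \<noteq> classify T e}) k ?st 1 (of_bool d) ?\<sigma> a' c')"
      if "state_at visit_pc A k ?st 1 (of_bool d) ?\<sigma> 0 c'" for c'
      using that T(1,2) st'(2)
      by (rule visit_inner) (use card card'[of "\<lambda>_. True"] A in simp_all)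
    ultimately have "runs prog W (12 + 86 * nodes T) c (\<lambda>c'. \<exists>a'. state_at return_pc
        (A + card {e \<in> completions X ?\<sigma>. d \<noteq> classify T e}) k ?st 1 (of_bool d) ?\<sigma> a' c')"
      by (rule runs_trans)
    moreover have "runs prog W 10 c' (\<lambda>c'. \<exists>a'. state_at return_pc
        (A + card {e \<in> completions X \<sigma>. d \<noteq> classify T (e(x := True))}) k st 0 0 \<sigma> a' c')"
      if "\<exists>a'. state_at return_pc
        (A + card {e \<in> completions X ?\<sigma>. d \<noteq> classify T e}) k ?st 1 (of_bool d) ?\<sigma> a' c'" for c'
    proof -
      from that obtain a' where "state_at return_pc
        (A + card {e \<in> completions X \<sigma>. d \<noteq> classify T (e(x := True))}) k ?st 1 (of_bool d) ?\<sigma> a' c'"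
        unfolding card' by blast
      from return_phase[OF this d st'(1)] show ?thesis
        unfolding \<sigma> by (rule runs_mono) blast+
    qed
    ultimately show "runs prog W (12 + 86 * nodes T + 10) c (\<lambda>c'. \<exists>a'. state_at return_pc
        (A + card {e \<in> completions X \<sigma>. d \<noteq> classify T (e(x := True))}) k st 0 0 \<sigma> a' c')"
      by (rule runs_trans)
  qed
  then show ?thesis by (simp add: add.commute)
qed

section \<open>From encodings to stored trees\<close>

lemma stored_encode:
  assumes "\<And>i. i < length (encode idx a t) \<Longrightarrow> m0 (a + i) = encode idx a t ! i"
    and "a + length (encode idx a t) \<le> L"
  shows "stored a t"
  using assms
proof (induction t arbitrary: a)
  case (Leaf d)
  from Leaf.prems(1)[of 0] Leaf.prems(1)[of 1] Leaf.prems(2) show ?case by simp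
next
  case (Node y p l r)
  let ?ls = "encode idx (a + 6) l"
  let ?rs = "encode idx (a + 6 + length ?ls) r"
  let ?hd = "[1, idx y, of_bool (p False), of_bool (p True), a + 6, a + 6 + length ?ls]"
  have enc: "encode idx a (Node y p l r) = ?hd @ ?ls @ ?rs"
    by (simp add: Let_def)
  note cell = Node.prems(1)[unfolded enc]
  have "stored (a + 6) l"
  proof (rule Node.IH(1))
    show "m0 (a + 6 + i) = ?ls ! i" if "i < length ?ls" for i
      using cell[of "length ?hd + i"] that
      by (simp only: nth_append_length_plus nth_append_left length_append) (simp add: eval_nat_numeral)
  qed (use Node.prems(2) in \<open>simp add: Let_def\<close>)
  moreover have "stored (a + 6 + length ?ls) r"
  proof (rule Node.IH(2))
    show "m0 (a + 6 + length ?ls + i) = ?rs ! i" if "i < length ?rs" for i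
      using cell[of "length ?hd + (length ?ls + i)"] that
      by (simp only: nth_append_length_plus length_append) (simp add: eval_nat_numeral ac_simps)
  qed (use Node.prems(2) in \<open>simp add: Let_def\<close>)
  moreover have "m0 a = 1" "m0 (a + 1) = idx y" "m0 (a + 2) = of_bool (p False)"
    "m0 (Suc (Suc (Suc a))) = of_bool (p True)" "m0 (4 + a) = a + 6" "m0 (a + 5) = a + 6 + length ?ls"
    using cell[of 0] cell[of 1] cell[of 2] cell[of 3] cell[of 4] cell[of 5]
    by (simp_all add: ac_simps numeral_eq_Suc)
  ultimately show ?case
    using Node.prems(2) by (simp add: Let_def)
qed

end

section \<open>Encoded inputs\<close>

lemma length_encode: "length (encode idx a t) \<le> 6 * nodes t"
  by (induction t arbitrary: a) (auto simp: Let_def intro: add_mono order_trans[OF add_mono])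

text \<open>Child addresses stay within the record of the tree and indices lie below
  \<open>N\<close>, so cell contents are linear in the input and fit the word size.\<close>

lemma encode_bound:
  assumes "\<And>y. y \<in> features t \<Longrightarrow> idx y < N" "v \<in> set (encode idx a t)"
  shows "v \<le> a + N + 6 * nodes t"
  using assms
proof (induction t arbitrary: a)
  case (Node y p l r)
  let ?ls = "encode idx (a + 6) l"
  have len: "length ?ls \<le> 6 * nodes l"
    by (rule length_encode)
  from Node.prems(2) consider "v \<in> {1, idx y, of_bool (p False), of_bool (p True), a + 6, a + 6 + length ?ls}"
    | "v \<in> set ?ls" | "v \<in> set (encode idx (a + 6 + length ?ls) r)"
    by (auto simp: Let_def)
  then show ?case
  proof cases
    case 1
    have "idx y < N" using Node.prems(1) by simp
    with 1 len show ?thesis by (cases "p False"; cases "p True") auto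
  next
    case 2
    with Node.IH(1)[of "a + 6"] Node.prems(1) show ?thesis by fastforce
  next
    case 3
    with Node.IH(2)[of "a + 6 + length ?ls"] Node.prems(1) len show ?thesis by fastforce
  qed
qed (auto simp: of_bool_def)

section \<open>Assembly of the time and word-size bounds\<close>

theorem corollary25:
  "\<exists>(P :: instr list) (C :: nat).
     \<forall>(X :: 'a set) (T :: 'a dtree) (x :: 'a) (idx :: 'a \<Rightarrow> nat).
       finite X \<longrightarrow> features T \<subseteq> X \<longrightarrow> x \<in> X \<longrightarrow> bij_betw idx X {..<card X} \<longrightarrow>
       outputs_within P (C * (card X + nodes T)) (C * (nodes T)\<^sup>2)
         (initial X idx T x)
         (card {e \<in> entities X. necessary X T e x})"
proof (rule exI[of _ prog], rule exI[of _ 200], intro allI impI)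
  fix X :: "'a set" and T :: "'a dtree" and x idx
  assume fin: "finite X" and T: "features T \<subseteq> X" and x: "x \<in> X"
    and idx: "bij_betw idx X {..<card X}"
  define N where "N = card X"
  define n where "n = nodes T"
  define w where "w = 200 * (N + n)"
  define cells where "cells = encode idx 0 T"
  define L where "L = length cells"
  define m0 where "m0 = (\<lambda>a. if a < L then cells ! a else 0)"
  define D where "D = card {e \<in> completions X [x \<mapsto> False]. classify T e \<noteq> classify T (e(x := True))}"
  have n: "n \<ge> 1"
    unfolding n_def by (cases T) simp_all
  have N: "N \<ge> 1"
    unfolding N_def using fin x by (metis One_nat_def Suc_leI card_gt_0_iff empty_iff)
  have idx_less: "idx y < N" if "y \<in> X" for y
    using bij_betwE[OF idx] that unfolding N_def by blast
  have L: "L \<le> 6 * n"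
    unfolding L_def cells_def n_def by (rule length_encode)
  have w: "w < 2 ^ w"
    by (rule less_exp)
  have m0_less: "m0 a < 2 ^ w" for a
  proof (cases "a < L")
    case True
    then have "m0 a \<in> set (encode idx 0 T)"
      by (simp add: m0_def L_def cells_def)
    then have "m0 a \<le> 0 + N + 6 * nodes T"
      using idx_less T by (intro encode_bound) auto
    also have "\<dots> \<le> w"
      by (simp add: w_def n_def)
    finally show ?thesis
      using w by linarith
  qed (simp add: m0_def)
  have "L + N + 2 * n + 10 \<le> w"
    using L n unfolding w_def distrib_left by linarith
  with w have large: "L + N + 2 * n + 10 < 2 ^ w"
    by linarith
  \<comment> \<open>The stack height \<open>2 * n\<close> allows one path for each of the two nested
    traversals.\<close>
  interpret machine X x idx m0 L N "2 * n" "2 ^ w"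
  proof unfold_locales
    show "inj_on idx X" using idx by (rule bij_betw_imp_inj_on)
    show "2 ^ N < (2::nat) ^ w" using n by (simp add: w_def)
  qed (use fin x idx_less m0_less large in auto)
  have stored: "stored 0 T"
    by (rule stored_encode) (simp_all add: m0_def L_def cells_def)
  have card: "card (completions X [x \<mapsto> False]) = 2 ^ (N - 1)"
    using card_completions_half[OF fin x, of "\<lambda>_. None" False] card_completions_None[OF fin] N
    unfolding N_def[symmetric] by (cases N) simp_all
  have power: "2 ^ (N - 1) + 2 ^ (N - 1) = (2::nat) ^ N"
    using N by (cases N) simp_all
  have "D \<le> 2 ^ (N - 1)"
    unfolding D_def card[symmetric] by (rule card_mono[OF finite_completions[OF fin]]) blast
  \<comment> \<open>The final doubling stays within \<open>2 ^ N\<close>.\<close>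
  then have D: "D + D < 2 ^ w"
    using power W_power by linarith
  have answer: "card {e \<in> entities X. necessary X T e x} = D + D"
    unfolding D_def card_necessary[OF fin x] by (rule mult_2)
  have init: "initial X idx T x = (0, (\<lambda>_. 0)(0 := N, 1 := idx x, 2 := L), m0)"
    unfolding initial_def Let_def m0_def L_def cells_def N_def ..
  have "runs prog (2 ^ w) 9 (initial X idx T x) (state_at visit_pc 0 (N - 1) [] 0 0 [x \<mapsto> False] 0)"
    unfolding init by (rule start[OF refl m0_less]) (simp_all add: m0_def)
  moreover have "runs prog (2 ^ w) ((86 * n + 96) * n) c (\<lambda>c'. \<exists>a'. state_at return_pc
      D (N - 1) [] 0 0 [x \<mapsto> False] a' c')"
    if "state_at visit_pc 0 (N - 1) [] 0 0 [x \<mapsto> False] 0 c" for c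
    using visit_outer[OF stored T _ that _ card] power
    by (simp add: n_def D_def)
  ultimately have "runs prog (2 ^ w) (9 + (86 * n + 96) * n) (initial X idx T x)
      (\<lambda>c'. \<exists>a'. state_at return_pc D (N - 1) [] 0 0 [x \<mapsto> False] a' c')"
    by (rule runs_trans)
  then have "runs prog (2 ^ w) (9 + (86 * n + 96) * n + 3) (initial X idx T x)
      (\<lambda>c. fst c = length prog \<and> fst (snd c) 0 = D + D)"
    by (rule runs_trans) (use finish D in auto)
  \<comment> \<open>As \<open>n \<ge> 1\<close>, the left side is at most 86 + 96 + 12 = 194 times
    \<open>n * n\<close>.\<close>
  moreover have "9 + (86 * n + 96) * n + 3 \<le> 200 * n\<^sup>2"
  proof -
    have "n \<le> n * n" "1 \<le> n * n" using n by simp_all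
    then show ?thesis unfolding power2_eq_square by (simp only: distrib_right mult.assoc)
  qed
  ultimately have "runs prog (2 ^ w) (200 * n\<^sup>2) (initial X idx T x)
      (\<lambda>c. halted prog c \<and> fst (snd c) 0 = D + D)"
    by (rule runs_mono) (auto simp: halted_def)
  then show "outputs_within prog (200 * (card X + nodes T)) (200 * (nodes T)\<^sup>2)
      (initial X idx T x) (card {e \<in> entities X. necessary X T e x})"
    unfolding outputs_within_def runs_def fits_iff_bounded answer w_def N_def n_def by blast
qed

end
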